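(* Let $R$ be a commutative unitary ring, let $(M,N,\imath,\pi,h)$ and $(A,B,i,p,k)$ be contractions of cochain complexes of $R$-modules, and let $f\colon N\to B$ be a morphism of acyclic retractions from $(M,N,\imath,\pi)$ to $(A,B,i,p)$. Then $$\tilde f=f-d\,k\,f\,h\,d\colon N\to B$$ is a morphism of contractions from $(M,N,\imath,\pi,h)$ to $(A,B,i,p,k)$. Moreover: (1) the morphism $f-\tilde f$ is homotopic to $0$; (2) $\tilde f=f$ whenever $f$ is a morphism of contractions; (3) the transformation $f\mapsto\tilde f$ commutes with compositions: if $(P,Q,j,q,l)$ is a further contraction and $g\colon B\to Q$ is a morphism of acyclic retractions from $(A,B,i,p)$ to $(P,Q,j,q)$, then $\widetilde{gf}=\tilde g\,\tilde f$, where $\tilde g=g-d\,l\,g\,k\,d$ and $\widetilde{gf}=gf-d\,l\,gf\,h\,d$.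
   Context: Cochain complexes are unbounded ($\mathbb{Z}$-graded), with differential $d$ of degree $+1$. An acyclic retraction is a quadruple $(M,N,\imath,\pi)$ where $M,N$ are cochain complexes of $R$-modules and $\imath\colon M\to N$, $\pi\colon N\to M$ are quasi-isomorphisms of cochain complexes with $\pi\imath=\mathrm{Id}_M$. A morphism of acyclic retractions $(M,N,\imath,\pi)\to(A,B,i,p)$ is a morphism of cochain complexes $f\colon N\to B$ such that $f\imath\pi=ipf$. A contraction is a tuple $(M,N,\imath,\pi,h)$ where $(M,N,\imath,\pi)$ is an acyclic retraction and $h$ is an $R$-linear map $N\to N$ of degree $-1$ such that $\imath\pi-\mathrm{Id}_N=d_Nh+hd_N$, $\pi h=0$, $h\imath=0$ and $h^2=0$. A morphism of contractions $(M,N,\imath,\pi,h)\to(A,B,i,p,k)$ is a morphism of cochain complexes $f\colon N\to B$ such that $fh=kf$; every such $f$ is also a morphism of acyclic retractions. *)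

theory Defs
  imports "HOL-Algebra.Module" "HOL-Algebra.AbelCoset"
begin

definition linear_maps ::
  "('r, 'z) ring_scheme \<Rightarrow> ('r, 'a, 'y) module_scheme \<Rightarrow> ('r, 'b, 'x) module_scheme \<Rightarrow> ('a \<Rightarrow> 'b) set"
  where
  "linear_maps R A B = {f \<in> carrier A \<rightarrow> carrier B.
     (\<forall>x\<in>carrier A. \<forall>y\<in>carrier A. f (x \<oplus>\<^bsub>A\<^esub> y) = f x \<oplus>\<^bsub>B\<^esub> f y) \<and>
     (\<forall>r\<in>carrier R. \<forall>x\<in>carrier A. f (r \<odot>\<^bsub>A\<^esub> x) = r \<odot>\<^bsub>B\<^esub> f x)}"

section \<open>Cochain complexes\<close>

text \<open>
  All degrees of a complex have their carriers in one type \<open>'a\<close>; this is no restriction, since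
  a family of modules can be placed in a disjoint union of their carriers.
  A graded map is a family \<open>f :: int \<Rightarrow> 'a \<Rightarrow> 'b\<close>, with \<open>f n\<close> defined on degree \<open>n\<close> of the source.
  Values outside the carriers are irrelevant, so graded maps are compared on the carriers only.
\<close>

record ('r, 'a) cochain =
  cpt :: "int \<Rightarrow> ('r, 'a) module"
  diff :: "int \<Rightarrow> 'a \<Rightarrow> 'a"

definition graded_map ::
  "('r, 'z) ring_scheme \<Rightarrow> ('r, 'a) cochain \<Rightarrow> ('r, 'b) cochain \<Rightarrow> int \<Rightarrow> (int \<Rightarrow> 'a \<Rightarrow> 'b) \<Rightarrow> bool"
  where
  "graded_map R C D k f \<longleftrightarrow> (\<forall>n. f n \<in> linear_maps R (cpt C n) (cpt D (n + k)))"

definition graded_eq :: "('r, 'a) cochain \<Rightarrow> (int \<Rightarrow> 'a \<Rightarrow> 'b) \<Rightarrow> (int \<Rightarrow> 'a \<Rightarrow> 'b) \<Rightarrow> bool"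
  where
  "graded_eq C f g \<longleftrightarrow> (\<forall>n. \<forall>x\<in>carrier (cpt C n). f n x = g n x)"

definition cochain_complex :: "('r, 'z) ring_scheme \<Rightarrow> ('r, 'a) cochain \<Rightarrow> bool"
  where
  "cochain_complex R C \<longleftrightarrow>
     (\<forall>n. module R (cpt C n)) \<and>
     graded_map R C C 1 (diff C) \<and>
     (\<forall>n. \<forall>x\<in>carrier (cpt C n). diff C (n + 1) (diff C n x) = \<zero>\<^bsub>cpt C (n + 2)\<^esub>)"

definition cochain_map ::
  "('r, 'z) ring_scheme \<Rightarrow> ('r, 'a) cochain \<Rightarrow> ('r, 'b) cochain \<Rightarrow> (int \<Rightarrow> 'a \<Rightarrow> 'b) \<Rightarrow> bool"
  where
  "cochain_map R C D f \<longleftrightarrow>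
     cochain_complex R C \<and> cochain_complex R D \<and>
     graded_map R C D 0 f \<and>
     (\<forall>n. \<forall>x\<in>carrier (cpt C n). f (n + 1) (diff C n x) = diff D n (f n x))"

definition graded_comp :: "(int \<Rightarrow> 'b \<Rightarrow> 'c) \<Rightarrow> (int \<Rightarrow> 'a \<Rightarrow> 'b) \<Rightarrow> int \<Rightarrow> 'a \<Rightarrow> 'c"
  where
  "graded_comp g f = (\<lambda>n. g n \<circ> f n)"

definition graded_zero :: "('r, 'b) cochain \<Rightarrow> int \<Rightarrow> 'a \<Rightarrow> 'b"
  where
  "graded_zero D = (\<lambda>n x. \<zero>\<^bsub>cpt D n\<^esub>)"

definition graded_minus ::
  "('r, 'b) cochain \<Rightarrow> (int \<Rightarrow> 'a \<Rightarrow> 'b) \<Rightarrow> (int \<Rightarrow> 'a \<Rightarrow> 'b) \<Rightarrow> int \<Rightarrow> 'a \<Rightarrow> 'b"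
  where
  "graded_minus D f g = (\<lambda>n x. f n x \<ominus>\<^bsub>cpt D n\<^esub> g n x)"

definition homotopic ::
  "('r, 'z) ring_scheme \<Rightarrow> ('r, 'a) cochain \<Rightarrow> ('r, 'b) cochain \<Rightarrow>
   (int \<Rightarrow> 'a \<Rightarrow> 'b) \<Rightarrow> (int \<Rightarrow> 'a \<Rightarrow> 'b) \<Rightarrow> bool"
  where
  "homotopic R C D f g \<longleftrightarrow>
     cochain_map R C D f \<and> cochain_map R C D g \<and>
     (\<exists>s. graded_map R C D (-1) s \<and>
       (\<forall>n. \<forall>x\<in>carrier (cpt C n).
          f n x \<ominus>\<^bsub>cpt D n\<^esub> g n x = diff D (n - 1) (s n x) \<oplus>\<^bsub>cpt D n\<^esub> s (n + 1) (diff C n x)))"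

section \<open>Cohomology and quasi-isomorphisms\<close>

definition cocycles :: "('r, 'a) cochain \<Rightarrow> int \<Rightarrow> 'a set"
  where
  "cocycles C n = {x \<in> carrier (cpt C n). diff C n x = \<zero>\<^bsub>cpt C (n + 1)\<^esub>}"

definition coboundaries :: "('r, 'a) cochain \<Rightarrow> int \<Rightarrow> 'a set"
  where
  "coboundaries C n = diff C (n - 1) ` carrier (cpt C (n - 1))"

text \<open>
  Cohomology is the quotient module of cosets. The fields \<open>mult\<close> and \<open>one\<close> are present because
  \<open>module\<close> records extend ring records; they carry no meaning for modules.
\<close>

definition cohomology :: "('r, 'a) cochain \<Rightarrow> int \<Rightarrow> ('r, 'a set) module"
  where
  "cohomology C n =
    \<lparr>carrier = (\<lambda>x. coboundaries C n +>\<^bsub>cpt C n\<^esub> x) ` cocycles C n,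
     mult = undefined,
     one = undefined,
     zero = coboundaries C n,
     add = set_add (cpt C n),
     smult = (\<lambda>r S. \<Union>x\<in>S. coboundaries C n +>\<^bsub>cpt C n\<^esub> (r \<odot>\<^bsub>cpt C n\<^esub> x))\<rparr>"

definition cohomology_map ::
  "('r, 'b) cochain \<Rightarrow> (int \<Rightarrow> 'a \<Rightarrow> 'b) \<Rightarrow> int \<Rightarrow> 'a set \<Rightarrow> 'b set"
  where
  "cohomology_map D f n S = (\<Union>x\<in>S. coboundaries D n +>\<^bsub>cpt D n\<^esub> f n x)"

definition quasi_isomorphism ::
  "('r, 'z) ring_scheme \<Rightarrow> ('r, 'a) cochain \<Rightarrow> ('r, 'b) cochain \<Rightarrow> (int \<Rightarrow> 'a \<Rightarrow> 'b) \<Rightarrow> bool"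
  where
  "quasi_isomorphism R C D f \<longleftrightarrow>
     cochain_map R C D f \<and>
     (\<forall>n. cohomology_map D f n \<in> linear_maps R (cohomology C n) (cohomology D n) \<and>
          bij_betw (cohomology_map D f n) (carrier (cohomology C n)) (carrier (cohomology D n)))"

section \<open>Acyclic retractions and contractions\<close>

definition acyclic_retraction ::
  "('r, 'z) ring_scheme \<Rightarrow> ('r, 'm) cochain \<Rightarrow> ('r, 'n) cochain \<Rightarrow>
   (int \<Rightarrow> 'm \<Rightarrow> 'n) \<Rightarrow> (int \<Rightarrow> 'n \<Rightarrow> 'm) \<Rightarrow> bool"
  where
  "acyclic_retraction R M N \<iota> \<pi> \<longleftrightarrow>
     quasi_isomorphism R M N \<iota> \<and> quasi_isomorphism R N M \<pi> \<and>
     (\<forall>n. \<forall>x\<in>carrier (cpt M n). \<pi> n (\<iota> n x) = x)"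

definition acyclic_retraction_morphism ::
  "('r, 'z) ring_scheme \<Rightarrow>
   ('r, 'm) cochain \<Rightarrow> ('r, 'n) cochain \<Rightarrow> (int \<Rightarrow> 'm \<Rightarrow> 'n) \<Rightarrow> (int \<Rightarrow> 'n \<Rightarrow> 'm) \<Rightarrow>
   ('r, 'a) cochain \<Rightarrow> ('r, 'b) cochain \<Rightarrow> (int \<Rightarrow> 'a \<Rightarrow> 'b) \<Rightarrow> (int \<Rightarrow> 'b \<Rightarrow> 'a) \<Rightarrow>
   (int \<Rightarrow> 'n \<Rightarrow> 'b) \<Rightarrow> bool"
  where
  "acyclic_retraction_morphism R M N \<iota> \<pi> A B i p f \<longleftrightarrow>
     acyclic_retraction R M N \<iota> \<pi> \<and> acyclic_retraction R A B i p \<and>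
     cochain_map R N B f \<and>
     (\<forall>n. \<forall>x\<in>carrier (cpt N n). f n (\<iota> n (\<pi> n x)) = i n (p n (f n x)))"

definition contraction ::
  "('r, 'z) ring_scheme \<Rightarrow> ('r, 'm) cochain \<Rightarrow> ('r, 'n) cochain \<Rightarrow>
   (int \<Rightarrow> 'm \<Rightarrow> 'n) \<Rightarrow> (int \<Rightarrow> 'n \<Rightarrow> 'm) \<Rightarrow> (int \<Rightarrow> 'n \<Rightarrow> 'n) \<Rightarrow> bool"
  where
  "contraction R M N \<iota> \<pi> h \<longleftrightarrow>
     acyclic_retraction R M N \<iota> \<pi> \<and>
     graded_map R N N (-1) h \<and>
     (\<forall>n. \<forall>x\<in>carrier (cpt N n).
        \<iota> n (\<pi> n x) \<ominus>\<^bsub>cpt N n\<^esub> x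
          = diff N (n - 1) (h n x) \<oplus>\<^bsub>cpt N n\<^esub> h (n + 1) (diff N n x)) \<and>
     (\<forall>n. \<forall>x\<in>carrier (cpt N n). \<pi> (n - 1) (h n x) = \<zero>\<^bsub>cpt M (n - 1)\<^esub>) \<and>
     (\<forall>n. \<forall>y\<in>carrier (cpt M n). h n (\<iota> n y) = \<zero>\<^bsub>cpt N (n - 1)\<^esub>) \<and>
     (\<forall>n. \<forall>x\<in>carrier (cpt N n). h (n - 1) (h n x) = \<zero>\<^bsub>cpt N (n - 2)\<^esub>)"

definition contraction_morphism ::
  "('r, 'z) ring_scheme \<Rightarrow>
   ('r, 'm) cochain \<Rightarrow> ('r, 'n) cochain \<Rightarrow> (int \<Rightarrow> 'm \<Rightarrow> 'n) \<Rightarrow> (int \<Rightarrow> 'n \<Rightarrow> 'm) \<Rightarrow> (int \<Rightarrow> 'n \<Rightarrow> 'n) \<Rightarrow>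
   ('r, 'a) cochain \<Rightarrow> ('r, 'b) cochain \<Rightarrow> (int \<Rightarrow> 'a \<Rightarrow> 'b) \<Rightarrow> (int \<Rightarrow> 'b \<Rightarrow> 'a) \<Rightarrow> (int \<Rightarrow> 'b \<Rightarrow> 'b) \<Rightarrow>
   (int \<Rightarrow> 'n \<Rightarrow> 'b) \<Rightarrow> bool"
  where
  "contraction_morphism R M N \<iota> \<pi> h A B i p k f \<longleftrightarrow>
     contraction R M N \<iota> \<pi> h \<and> contraction R A B i p k \<and>
     cochain_map R N B f \<and>
     (\<forall>n. \<forall>x\<in>carrier (cpt N n). f (n - 1) (h n x) = k n (f n x))"

definition tilde ::
  "('r, 'n) cochain \<Rightarrow> ('r, 'b) cochain \<Rightarrow> (int \<Rightarrow> 'n \<Rightarrow> 'n) \<Rightarrow> (int \<Rightarrow> 'b \<Rightarrow> 'b) \<Rightarrow>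
   (int \<Rightarrow> 'n \<Rightarrow> 'b) \<Rightarrow> int \<Rightarrow> 'n \<Rightarrow> 'b"
  where
  "tilde N B h k f =
     graded_minus B f (\<lambda>n x. diff B (n - 1) (k n (f n (h (n + 1) (diff N n x)))))"

end

theory Submission
  imports Defs
begin

text \<open>
  Write \<open>e = \<iota>\<pi>\<close> and \<open>F\<close> for \<open>tilde f\<close>. The side conditions give \<open>hdh = -h\<close> and \<open>kdk = -k\<close>, and both
  \<open>F h\<close> and \<open>k F\<close> turn out to be \<open>-k f d h\<close>. Since \<open>Id = e - dh - hd\<close>, a morphism of contractions
  is determined by its values on the images of \<open>d\<close> and \<open>e\<close>, and \<open>F\<close> agrees with \<open>f\<close> there. Hence
  \<open>F\<close> is the unique morphism of contractions agreeing with \<open>f\<close> on these images, which yields both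
  (2) and (3). Finally \<open>f - F = ds + sd\<close> for \<open>s = k f h d\<close>, because \<open>d\<^sup>2 = 0\<close>.
\<close>

section \<open>Linear maps\<close>

lemma module_abelian_group: "module R A \<Longrightarrow> abelian_group A"
  by (simp add: module_def)

lemma linear_maps_closed: "f \<in> linear_maps R A B \<Longrightarrow> x \<in> carrier A \<Longrightarrow> f x \<in> carrier B"
  by (auto simp: linear_maps_def)

lemma linear_maps_add:
  "f \<in> linear_maps R A B \<Longrightarrow> x \<in> carrier A \<Longrightarrow> y \<in> carrier A \<Longrightarrow> f (x \<oplus>\<^bsub>A\<^esub> y) = f x \<oplus>\<^bsub>B\<^esub> f y"
  by (auto simp: linear_maps_def)

lemma linear_maps_smult:
  "f \<in> linear_maps R A B \<Longrightarrow> r \<in> carrier R \<Longrightarrow> x \<in> carrier A \<Longrightarrow> f (r \<odot>\<^bsub>A\<^esub> x) = r \<odot>\<^bsub>B\<^esub> f x"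
  by (auto simp: linear_maps_def)

text \<open>Makes the library facts on images of zero and of negatives available for linear
  maps.\<close>

lemma linear_maps_abelian_group_hom:
  assumes "module R A" "module R B" "f \<in> linear_maps R A B"
  shows "abelian_group_hom A B f"
  using assms
  by (intro abelian_group_homI module_abelian_group group_hom.intro group_hom_axioms.intro
      abelian_group.a_group)
    (auto simp: linear_maps_def hom_def)

lemma linear_maps_zero:
  assumes "module R A" "module R B" "f \<in> linear_maps R A B"
  shows "f \<zero>\<^bsub>A\<^esub> = \<zero>\<^bsub>B\<^esub>"
  using linear_maps_abelian_group_hom[OF assms] by (rule abelian_group_hom.hom_zero)

lemma linear_maps_uminus:
  assumes "module R A" "module R B" "f \<in> linear_maps R A B" "x \<in> carrier A"
  shows "f (\<ominus>\<^bsub>A\<^esub> x) = \<ominus>\<^bsub>B\<^esub> f x"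
  using linear_maps_abelian_group_hom[OF assms(1-3)] assms(4) by (rule abelian_group_hom.hom_a_inv)

lemma linear_maps_minus:
  assumes "module R A" "module R B" "f \<in> linear_maps R A B" "x \<in> carrier A" "y \<in> carrier A"
  shows "f (x \<ominus>\<^bsub>A\<^esub> y) = f x \<ominus>\<^bsub>B\<^esub> f y"
proof -
  interpret A: abelian_group A using assms(1) by (rule module_abelian_group)
  show ?thesis
    using assms by (simp add: a_minus_def linear_maps_add linear_maps_uminus)
qed

lemma linear_maps_comp:
  assumes "f \<in> linear_maps R A B" "g \<in> linear_maps R B C"
  shows "(\<lambda>x. g (f x)) \<in> linear_maps R A C"
  using assms by (auto simp: linear_maps_def Pi_iff)

lemma linear_maps_diff:
  assumes "module R A" "module R B" "f \<in> linear_maps R A B" "g \<in> linear_maps R A B"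
  shows "(\<lambda>x. f x \<ominus>\<^bsub>B\<^esub> g x) \<in> linear_maps R A B"
proof -
  interpret B: module R B by fact
  note cl = linear_maps_closed[OF assms(3)] linear_maps_closed[OF assms(4)]
  show ?thesis
    unfolding linear_maps_def
  proof (intro CollectI conjI ballI funcsetI)
    fix x y assume xy: "x \<in> carrier A" "y \<in> carrier A"
    show "f (x \<oplus>\<^bsub>A\<^esub> y) \<ominus>\<^bsub>B\<^esub> g (x \<oplus>\<^bsub>A\<^esub> y) = f x \<ominus>\<^bsub>B\<^esub> g x \<oplus>\<^bsub>B\<^esub> (f y \<ominus>\<^bsub>B\<^esub> g y)"
      using xy cl assms(3,4)
      by (simp add: linear_maps_add a_minus_def B.minus_add B.a_ac)
  next
    fix r x assume rx: "r \<in> carrier R" "x \<in> carrier A"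
    show "f (r \<odot>\<^bsub>A\<^esub> x) \<ominus>\<^bsub>B\<^esub> g (r \<odot>\<^bsub>A\<^esub> x) = r \<odot>\<^bsub>B\<^esub> (f x \<ominus>\<^bsub>B\<^esub> g x)"
      using rx cl assms(3,4)
      by (simp add: linear_maps_smult a_minus_def B.smult_r_distr B.smult_r_minus)
  qed (use cl in simp)
qed

section \<open>Cochain maps\<close>

lemma cochain_complex_module: "cochain_complex R C \<Longrightarrow> module R (cpt C n)"
  by (simp add: cochain_complex_def)

lemma cochain_complex_diff:
  "cochain_complex R C \<Longrightarrow> diff C n \<in> linear_maps R (cpt C n) (cpt C (n + 1))"
  by (simp add: cochain_complex_def graded_map_def)

text \<open>The free index \<open>m\<close> lets the rule apply to degrees that are not literally of
  the form \<open>n + 1\<close>, for example to \<open>n - 1\<close> followed by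
  \<open>n\<close>.\<close>

lemma cochain_complex_diff_diff:
  assumes "cochain_complex R C" "x \<in> carrier (cpt C n)" "m = n + 1"
  shows "diff C m (diff C n x) = \<zero>\<^bsub>cpt C (n + 2)\<^esub>"
  using assms by (simp add: cochain_complex_def)

lemma cochain_map_linear: "cochain_map R C D f \<Longrightarrow> f n \<in> linear_maps R (cpt C n) (cpt D n)"
  by (simp add: cochain_map_def graded_map_def)

lemma cochain_map_diff:
  "cochain_map R C D f \<Longrightarrow> x \<in> carrier (cpt C n) \<Longrightarrow> f (n + 1) (diff C n x) = diff D n (f n x)"
  by (simp add: cochain_map_def)

lemma cochain_mapD:
  assumes "cochain_map R C D f"
  shows "cochain_complex R C" "cochain_complex R D"
  using assms by (simp_all add: cochain_map_def)

lemma cochain_map_comp: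
  assumes f: "cochain_map R C D f" and g: "cochain_map R D E g"
  shows "cochain_map R C E (graded_comp g f)"
proof -
  have "(\<lambda>x. g n (f n x)) \<in> linear_maps R (cpt C n) (cpt E n)" for n
    by (rule linear_maps_comp[OF cochain_map_linear[OF f] cochain_map_linear[OF g]])
  moreover have "g (n + 1) (f (n + 1) (diff C n x)) = diff E n (g n (f n x))"
    if x: "x \<in> carrier (cpt C n)" for n x
    by (simp add: cochain_map_diff[OF f x]
        cochain_map_diff[OF g linear_maps_closed[OF cochain_map_linear[OF f] x]])
  ultimately show ?thesis
    using cochain_mapD(1)[OF f] cochain_mapD(2)[OF g]
    by (simp add: cochain_map_def graded_map_def graded_comp_def comp_def)
qed

lemma cochain_map_minus:
  assumes f: "cochain_map R C D f" and g: "cochain_map R C D g"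
  shows "cochain_map R C D (graded_minus D f g)"
proof -
  note C = cochain_mapD(1)[OF f] and D = cochain_mapD(2)[OF f]
  note mod = cochain_complex_module[OF C] cochain_complex_module[OF D]
  have "graded_map R C D 0 (graded_minus D f g)"
    using linear_maps_diff[OF mod cochain_map_linear[OF f] cochain_map_linear[OF g]]
    by (simp add: graded_map_def graded_minus_def)
  moreover have "graded_minus D f g (n + 1) (diff C n x) = diff D n (graded_minus D f g n x)"
    if x: "x \<in> carrier (cpt C n)" for n x
    using linear_maps_minus[OF mod(2) mod(2) cochain_complex_diff[OF D]
        linear_maps_closed[OF cochain_map_linear[OF f] x] linear_maps_closed[OF cochain_map_linear[OF g] x]]
    by (simp add: graded_minus_def cochain_map_diff[OF f x] cochain_map_diff[OF g x])
  ultimately show ?thesis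
    using C D by (simp add: cochain_map_def)
qed

text \<open>Needed because \<open>homotopic\<close> demands that both maps it compares are cochain
  maps.\<close>

lemma cochain_map_zero:
  assumes C: "cochain_complex R C" and D: "cochain_complex R D"
  shows "cochain_map R C D (graded_zero D)"
proof -
  have "(\<lambda>x. \<zero>\<^bsub>cpt D n\<^esub>) \<in> linear_maps R (cpt C n) (cpt D n)" for n
  proof -
    interpret D: module R "cpt D n" using D by (rule cochain_complex_module)
    show ?thesis by (auto simp: linear_maps_def)
  qed
  then show ?thesis
    using C D linear_maps_zero[OF cochain_complex_module[OF D] cochain_complex_module[OF D] cochain_complex_diff[OF D]]
    by (simp add: cochain_map_def graded_map_def graded_zero_def)
qed

section \<open>Contractions\<close>

lemma acyclic_retraction_cochain_map:
  assumes "acyclic_retraction R M N \<iota> \<pi>"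
  shows "cochain_map R M N \<iota>" "cochain_map R N M \<pi>"
  using assms by (simp_all add: acyclic_retraction_def quasi_isomorphism_def)

lemma contraction_linear:
  assumes "contraction R M N \<iota> \<pi> h"
  shows "h n \<in> linear_maps R (cpt N n) (cpt N (n - 1))"
  using assms by (simp add: contraction_def graded_map_def)

lemma contraction_acyclic_retraction:
  "contraction R M N \<iota> \<pi> h \<Longrightarrow> acyclic_retraction R M N \<iota> \<pi>"
  by (simp add: contraction_def)

lemma contraction_complex: "contraction R M N \<iota> \<pi> h \<Longrightarrow> cochain_complex R N"
  using contraction_acyclic_retraction[THEN acyclic_retraction_cochain_map(1), THEN cochain_mapD(2)] .

section \<open>Identities between \<open>d\<close>, \<open>h\<close> and the projection
  \<open>e\<close>\<close>

lemma contraction_homotopy: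
  assumes "contraction R M N \<iota> \<pi> h" "x \<in> carrier (cpt N n)"
  shows "\<iota> n (\<pi> n x) \<ominus>\<^bsub>cpt N n\<^esub> x = diff N (n - 1) (h n x) \<oplus>\<^bsub>cpt N n\<^esub> h (n + 1) (diff N n x)"
  using assms by (simp add: contraction_def)

lemma contraction_side:
  assumes "contraction R M N \<iota> \<pi> h"
  shows "x \<in> carrier (cpt N n) \<Longrightarrow> \<pi> (n - 1) (h n x) = \<zero>\<^bsub>cpt M (n - 1)\<^esub>"
    and "y \<in> carrier (cpt M n) \<Longrightarrow> h n (\<iota> n y) = \<zero>\<^bsub>cpt N (n - 1)\<^esub>"
    and "x \<in> carrier (cpt N n) \<Longrightarrow> h (n - 1) (h n x) = \<zero>\<^bsub>cpt N (n - 2)\<^esub>"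
  using assms by (simp_all add: contraction_def)

lemma contraction_closed:
  assumes con: "contraction R M N \<iota> \<pi> h" and x: "x \<in> carrier (cpt N n)"
  shows "h n x \<in> carrier (cpt N (n - 1))" "diff N n x \<in> carrier (cpt N (n + 1))"
    "diff N (n - 1) (h n x) \<in> carrier (cpt N n)" "h (n + 1) (diff N n x) \<in> carrier (cpt N n)"
    "\<pi> n x \<in> carrier (cpt M n)" "\<iota> n (\<pi> n x) \<in> carrier (cpt N n)"
proof -
  note c = contraction_complex[OF con]
  note maps = acyclic_retraction_cochain_map[OF contraction_acyclic_retraction[OF con]]
  show h: "h n x \<in> carrier (cpt N (n - 1))"
    by (rule linear_maps_closed[OF contraction_linear[OF con] x])
  show d: "diff N n x \<in> carrier (cpt N (n + 1))"
    by (rule linear_maps_closed[OF cochain_complex_diff[OF c] x])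
  show "diff N (n - 1) (h n x) \<in> carrier (cpt N n)"
    using linear_maps_closed[OF cochain_complex_diff[OF c] h] by simp
  show "h (n + 1) (diff N n x) \<in> carrier (cpt N n)"
    using linear_maps_closed[OF contraction_linear[OF con] d] by simp
  show pi: "\<pi> n x \<in> carrier (cpt M n)"
    by (rule linear_maps_closed[OF cochain_map_linear[OF maps(2)] x])
  show "\<iota> n (\<pi> n x) \<in> carrier (cpt N n)"
    by (rule linear_maps_closed[OF cochain_map_linear[OF maps(1)] pi])
qed

lemma contraction_proj_h:
  assumes con: "contraction R M N \<iota> \<pi> h" and x: "x \<in> carrier (cpt N n)"
  shows "\<iota> (n - 1) (\<pi> (n - 1) (h n x)) = \<zero>\<^bsub>cpt N (n - 1)\<^esub>"
proof -
  note maps = acyclic_retraction_cochain_map[OF contraction_acyclic_retraction[OF con]]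
  show ?thesis
    unfolding contraction_side(1)[OF con x]
    using maps by (intro linear_maps_zero cochain_map_linear cochain_complex_module cochain_mapD)
qed

lemma contraction_h_proj:
  assumes con: "contraction R M N \<iota> \<pi> h" and x: "x \<in> carrier (cpt N n)"
  shows "h n (\<iota> n (\<pi> n x)) = \<zero>\<^bsub>cpt N (n - 1)\<^esub>"
  by (rule contraction_side(2)[OF con contraction_closed(5)[OF con x]])

text \<open>As \<iota> and \<pi> are cochain maps, \<open>e\<close> commutes with \<open>d\<close>;
  hence \<open>h d e = h e d\<close>, and \<open>h e = 0\<close>.\<close>

lemma contraction_h_diff_proj:
  assumes con: "contraction R M N \<iota> \<pi> h" and x: "x \<in> carrier (cpt N n)"
  shows "h (n + 1) (diff N n (\<iota> n (\<pi> n x))) = \<zero>\<^bsub>cpt N n\<^esub>"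
proof -
  note maps = acyclic_retraction_cochain_map[OF contraction_acyclic_retraction[OF con]]
  have "diff N n (\<iota> n (\<pi> n x)) = \<iota> (n + 1) (\<pi> (n + 1) (diff N n x))"
    by (simp add: cochain_map_diff[OF maps(2) x]
        cochain_map_diff[OF maps(1) contraction_closed(5)[OF con x]])
  then show ?thesis
    using contraction_h_proj[OF con contraction_closed(2)[OF con x]] by simp
qed

text \<open>The homotopy formula evaluated at \<open>h x\<close>: \<open>e h = 0\<close> and
  \<open>d h h = 0\<close> leave \<open>- h x = h d h x\<close>.\<close>

lemma contraction_h_diff_h:
  assumes con: "contraction R M N \<iota> \<pi> h" and x: "x \<in> carrier (cpt N n)"
  shows "h n (diff N (n - 1) (h n x)) = \<ominus>\<^bsub>cpt N (n - 1)\<^esub> h n x"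
proof -
  note c = contraction_complex[OF con]
  note hx = contraction_closed(1)[OF con x]
  interpret abelian_group "cpt N (n - 1)"
    by (rule module_abelian_group[OF cochain_complex_module[OF c]])
  \<comment> \<open>The homotopy formula is used in degree \<open>n - 1\<close>, so the vanishing
    \<open>h h x\<close> lies in degree \<open>n - 2\<close>, and \<open>d\<close> has to be applied
    to that zero.\<close>
  have "diff N (n - 2) \<zero>\<^bsub>cpt N (n - 2)\<^esub> = \<zero>\<^bsub>cpt N (n - 1)\<^esub>"
    using linear_maps_zero[OF cochain_complex_module[OF c] cochain_complex_module[OF c] cochain_complex_diff[OF c], of "n - 2"]
    by simp
  then show ?thesis
    using contraction_homotopy[OF con hx] contraction_side(3)[OF con x] contraction_proj_h[OF con x]
      contraction_closed(4)[OF con hx] hx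
    by (simp add: a_minus_def)
qed

text \<open>The homotopy formula solved for \<open>x\<close>. It serves to expand a linear map along
  \<open>Id = e - (d h + h d)\<close>.\<close>

lemma contraction_decomposition:
  assumes con: "contraction R M N \<iota> \<pi> h" and x: "x \<in> carrier (cpt N n)"
  shows "x = \<iota> n (\<pi> n x) \<ominus>\<^bsub>cpt N n\<^esub> (diff N (n - 1) (h n x) \<oplus>\<^bsub>cpt N n\<^esub> h (n + 1) (diff N n x))"
proof -
  interpret abelian_group "cpt N n"
    by (rule module_abelian_group[OF cochain_complex_module[OF contraction_complex[OF con]]])
  show ?thesis
    unfolding contraction_homotopy[OF con x, symmetric]
    using x contraction_closed(6)[OF con x] by (simp add: a_minus_def minus_add r_neg2)
qed

text \<open>A contraction morphism \<open>F\<close> applied to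
  \<open>x = e x - (d h x + h d x)\<close> involves its values on the images of \<open>e\<close> and
  \<open>d\<close>, plus \<open>F h d x = k F d x\<close>, which is again fixed by the values on the
  image of \<open>d\<close>.\<close>

lemma contraction_morphism_unique:
  assumes f: "contraction_morphism R M N \<iota> \<pi> h A B i p k f"
    and g: "contraction_morphism R M N \<iota> \<pi> h A B i p k g"
    and proj: "\<And>n x. x \<in> carrier (cpt N n) \<Longrightarrow> f n (\<iota> n (\<pi> n x)) = g n (\<iota> n (\<pi> n x))"
    and diff: "\<And>n x. x \<in> carrier (cpt N n) \<Longrightarrow> f (n + 1) (diff N n x) = g (n + 1) (diff N n x)"
  shows "graded_eq N f g"
  unfolding graded_eq_def
proof (intro allI ballI)
  fix n x assume x: "x \<in> carrier (cpt N n)"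
  from f g have con: "contraction R M N \<iota> \<pi> h" and fm: "cochain_map R N B f" and gm: "cochain_map R N B g"
    by (auto simp: contraction_morphism_def)
  note cl = contraction_closed[OF con x]
  interpret N: abelian_group "cpt N n"
    by (rule module_abelian_group[OF cochain_complex_module[OF cochain_mapD(1)[OF fm]]])
  have expand: "F n x = F n (\<iota> n (\<pi> n x)) \<ominus>\<^bsub>cpt B n\<^esub>
      (F n (diff N (n - 1) (h n x)) \<oplus>\<^bsub>cpt B n\<^esub> k (n + 1) (F (n + 1) (diff N n x)))"
    if F: "contraction_morphism R M N \<iota> \<pi> h A B i p k F" for F
  proof -
    from F have Fm: "cochain_map R N B F" by (simp add: contraction_morphism_def)
    note lin = cochain_map_linear[OF Fm]
    note mod = cochain_mapD[OF Fm, THEN cochain_complex_module]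
    have "F n (h (n + 1) (diff N n x)) = k (n + 1) (F (n + 1) (diff N n x))"
      using F cl(2) by (force simp: contraction_morphism_def)
    then show ?thesis
      \<comment> \<open>A single substitution, since \<open>x\<close> occurs on the right of the
        decomposition as well and simplification with it would loop.\<close>
      by (subst contraction_decomposition[OF con x])
        (simp add: cl linear_maps_minus[OF mod lin] linear_maps_add[OF lin])
  qed
  \<comment> \<open>\<open>d h x\<close> is a value of \<open>d\<close> at an element of degree
    \<open>n - 1\<close>, so the hypothesis is used one degree lower.\<close>
  have "f n (diff N (n - 1) (h n x)) = g n (diff N (n - 1) (h n x))"
    using diff[OF cl(1)] by simp
  then show "f n x = g n x"
    by (simp add: expand[OF f] expand[OF g] proj[OF x] diff[OF x])
qed

section \<open>Composition of morphisms\<close>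

lemma acyclic_retraction_morphism_comp:
  assumes f: "acyclic_retraction_morphism R M N \<iota> \<pi> A B i p f"
    and g: "acyclic_retraction_morphism R A B i p P Q j q g"
  shows "acyclic_retraction_morphism R M N \<iota> \<pi> P Q j q (graded_comp g f)"
proof -
  from f g have fm: "cochain_map R N B f" and gm: "cochain_map R B Q g"
    by (simp_all add: acyclic_retraction_morphism_def)
  have "f n x \<in> carrier (cpt B n)" if "x \<in> carrier (cpt N n)" for n x
    by (rule linear_maps_closed[OF cochain_map_linear[OF fm] that])
  then show ?thesis
    using f g cochain_map_comp[OF fm gm]
    by (simp add: acyclic_retraction_morphism_def graded_comp_def)
qed

text \<open>Makes the composite of two rectified maps a candidate in the uniqueness argument for
  (3).\<close>

lemma contraction_morphism_comp:
  assumes f: "contraction_morphism R M N \<iota> \<pi> h A B i p k f"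
    and g: "contraction_morphism R A B i p k P Q j q l g"
  shows "contraction_morphism R M N \<iota> \<pi> h P Q j q l (graded_comp g f)"
proof -
  from f g have fm: "cochain_map R N B f" and gm: "cochain_map R B Q g"
    by (simp_all add: contraction_morphism_def)
  have "f n x \<in> carrier (cpt B n)" if "x \<in> carrier (cpt N n)" for n x
    by (rule linear_maps_closed[OF cochain_map_linear[OF fm] that])
  then show ?thesis
    using f g cochain_map_comp[OF fm gm]
    by (simp add: contraction_morphism_def graded_comp_def)
qed

section \<open>The rectified morphism\<close>

text \<open>A locale, because the construction is needed for \<open>f\<close>, \<open>g\<close> and
  \<open>graded_comp g f\<close> at once when compositions are treated.\<close>

locale retraction_morphism_of_contractions =
  fixes R :: "('r, 'z) ring_scheme"
    and M :: "('r, 'm) cochain" and N :: "('r, 'n) cochain"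
    and \<iota> :: "int \<Rightarrow> 'm \<Rightarrow> 'n" and \<pi> :: "int \<Rightarrow> 'n \<Rightarrow> 'm" and h :: "int \<Rightarrow> 'n \<Rightarrow> 'n"
    and A :: "('r, 'a) cochain" and B :: "('r, 'b) cochain"
    and i :: "int \<Rightarrow> 'a \<Rightarrow> 'b" and p :: "int \<Rightarrow> 'b \<Rightarrow> 'a" and k :: "int \<Rightarrow> 'b \<Rightarrow> 'b"
    and f :: "int \<Rightarrow> 'n \<Rightarrow> 'b"
  assumes source: "contraction R M N \<iota> \<pi> h"
    and target: "contraction R A B i p k"
    and morphism: "acyclic_retraction_morphism R M N \<iota> \<pi> A B i p f"
begin

text \<open>The correction \<open>d k f h d = f - F\<close>, which turns out to be
  null-homotopic.\<close>

definition null_part :: "int \<Rightarrow> 'n \<Rightarrow> 'b" where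
  "null_part n x = diff B (n - 1) (k n (f n (h (n + 1) (diff N n x))))"

lemma tilde_eq: "tilde N B h k f = graded_minus B f null_part"
  by (simp add: tilde_def null_part_def[abs_def])

lemma f_map: "cochain_map R N B f"
  using morphism by (simp add: acyclic_retraction_morphism_def)

lemma f_proj: "x \<in> carrier (cpt N n) \<Longrightarrow> f n (\<iota> n (\<pi> n x)) = i n (p n (f n x))"
  using morphism by (simp add: acyclic_retraction_morphism_def)

lemmas source_complex = contraction_complex[OF source]
lemmas target_complex = contraction_complex[OF target]
lemmas source_module = cochain_complex_module[OF source_complex]
lemmas target_module = cochain_complex_module[OF target_complex]
lemmas f_linear = cochain_map_linear[OF f_map]
lemmas f_closed = linear_maps_closed[OF f_linear]
lemmas f_zero = linear_maps_zero[OF source_module target_module f_linear]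
lemmas f_uminus = linear_maps_uminus[OF source_module target_module f_linear]
lemmas k_linear = contraction_linear[OF target]
lemmas k_zero = linear_maps_zero[OF target_module target_module k_linear]
lemmas k_minus = linear_maps_minus[OF target_module target_module k_linear]

text \<open>Treating \<open>h d\<close>, and below \<open>d k\<close>, as maps of degree 0 settles
  the shifts \<open>n + 1 - 1\<close> and \<open>n - 1 + 1\<close> once and for all.\<close>

lemma h_diff_linear: "(\<lambda>x. h (n + 1) (diff N n x)) \<in> linear_maps R (cpt N n) (cpt N n)"
  using linear_maps_comp[OF cochain_complex_diff[OF source_complex] contraction_linear[OF source], of n]
  by simp

lemma diff_k_linear: "(\<lambda>x. diff B (n - 1) (k n x)) \<in> linear_maps R (cpt B n) (cpt B n)"
  using linear_maps_comp[OF k_linear cochain_complex_diff[OF target_complex], of n] by simp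

lemmas diff_k_zero = linear_maps_zero[OF target_module target_module diff_k_linear]
lemmas diff_k_uminus = linear_maps_uminus[OF target_module target_module diff_k_linear]

lemma k_f_h_diff_linear:
  "(\<lambda>x. k n (f n (h (n + 1) (diff N n x)))) \<in> linear_maps R (cpt N n) (cpt B (n - 1))"
  by (rule linear_maps_comp[OF linear_maps_comp[OF h_diff_linear f_linear] k_linear])

lemma null_part_linear: "null_part n \<in> linear_maps R (cpt N n) (cpt B n)"
  using linear_maps_comp[OF linear_maps_comp[OF h_diff_linear f_linear] diff_k_linear, of n]
  by (simp add: null_part_def[abs_def])

lemmas null_part_closed = linear_maps_closed[OF null_part_linear]

text \<open>The correction is \<open>d k f\<close> applied to \<open>h d x\<close>. This reduces
  agreement of \<open>F\<close> with \<open>f\<close> to the vanishing of \<open>h d\<close>, which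
  holds on the images of \<open>d\<close> and \<open>e\<close>.\<close>

lemma null_part_zero:
  "h (n + 1) (diff N n x) = \<zero>\<^bsub>cpt N n\<^esub> \<Longrightarrow> null_part n x = \<zero>\<^bsub>cpt B n\<^esub>"
  by (simp add: null_part_def f_zero diff_k_zero)

lemma h_diff_diff:
  assumes "x \<in> carrier (cpt N n)"
  shows "h (n + 2) (diff N (n + 1) (diff N n x)) = \<zero>\<^bsub>cpt N (n + 1)\<^esub>"
  using linear_maps_zero[OF source_module source_module contraction_linear[OF source], of "n + 2"]
  by (simp add: add.commute cochain_complex_diff_diff[OF source_complex assms])

lemma null_part_diff:
  assumes "x \<in> carrier (cpt N n)"
  shows "null_part (n + 1) (diff N n x) = \<zero>\<^bsub>cpt B (n + 1)\<^esub>"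
  using h_diff_diff[OF assms] by (intro null_part_zero) (simp add: add.assoc)

lemma null_part_proj:
  assumes "x \<in> carrier (cpt N n)"
  shows "null_part n (\<iota> n (\<pi> n x)) = \<zero>\<^bsub>cpt B n\<^esub>"
  by (rule null_part_zero[OF contraction_h_diff_proj[OF source assms]])

text \<open>Both composites with the differential vanish: the outer \<open>d\<close> is killed by
  the differential of \<open>B\<close>, the inner \<open>d\<close> by that of
  \<open>N\<close>.\<close>

lemma null_part_map: "cochain_map R N B null_part"
proof -
  have "diff B n (null_part n x) = \<zero>\<^bsub>cpt B (n + 1)\<^esub>" if "x \<in> carrier (cpt N n)" for n x
  proof -
    have "k n (f n (h (n + 1) (diff N n x))) \<in> carrier (cpt B (n - 1))"
      by (rule linear_maps_closed[OF k_f_h_diff_linear that])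
    from cochain_complex_diff_diff[OF target_complex this, of n]
    show ?thesis by (simp add: null_part_def add.commute)
  qed
  then show ?thesis
    using source_complex target_complex null_part_linear null_part_diff
    by (simp add: cochain_map_def graded_map_def)
qed

section \<open>The rectified map on the images of \<open>d\<close>, \<open>e\<close> and
  \<open>h\<close>\<close>

lemma tilde_map: "cochain_map R N B (tilde N B h k f)"
  unfolding tilde_eq by (rule cochain_map_minus[OF f_map null_part_map])

lemma tilde_eq_of_null:
  assumes "x \<in> carrier (cpt N n)" "null_part n x = \<zero>\<^bsub>cpt B n\<^esub>"
  shows "tilde N B h k f n x = f n x"
proof -
  interpret abelian_group "cpt B n" by (rule module_abelian_group[OF target_module])
  show ?thesis
    using assms f_closed by (simp add: tilde_eq graded_minus_def a_minus_def)
qed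

lemma tilde_diff:
  "x \<in> carrier (cpt N n) \<Longrightarrow> tilde N B h k f (n + 1) (diff N n x) = f (n + 1) (diff N n x)"
  by (intro tilde_eq_of_null null_part_diff contraction_closed(2)[OF source])

lemma tilde_proj:
  "x \<in> carrier (cpt N n) \<Longrightarrow> tilde N B h k f n (\<iota> n (\<pi> n x)) = f n (\<iota> n (\<pi> n x))"
  by (intro tilde_eq_of_null null_part_proj contraction_closed(6)[OF source])

text \<open>Put \<open>u = f h x\<close>. By \<open>h d h = - h\<close>,
  \<open>F h x = u + d k u\<close>. The homotopy formula of the target gives
  \<open>- u = d k u + k d u\<close>, because \<open>i p u = f e h x = 0\<close>. Hence
  \<open>F h x = - k d u\<close>, and \<open>d u = f d h x\<close>.\<close>

lemma tilde_h:
  assumes x: "x \<in> carrier (cpt N n)"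
  shows "tilde N B h k f (n - 1) (h n x) = \<ominus>\<^bsub>cpt B (n - 1)\<^esub> k n (f n (diff N (n - 1) (h n x)))"
proof -
  interpret B: abelian_group "cpt B (n - 1)" by (rule module_abelian_group[OF target_module])
  note hx = contraction_closed(1)[OF source x]
  define u where "u = f (n - 1) (h n x)"
  have u: "u \<in> carrier (cpt B (n - 1))"
    unfolding u_def by (rule f_closed[OF hx])
  note cl = contraction_closed[OF target u]
  have "null_part (n - 1) (h n x) = \<ominus>\<^bsub>cpt B (n - 1)\<^esub> diff B (n - 2) (k (n - 1) u)"
    using diff_k_uminus[OF u] by (simp add: null_part_def contraction_h_diff_h[OF source x] f_uminus[OF hx] u_def)
  then have "tilde N B h k f (n - 1) (h n x) = u \<oplus>\<^bsub>cpt B (n - 1)\<^esub> diff B (n - 2) (k (n - 1) u)"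
    using cl by (simp add: tilde_eq graded_minus_def a_minus_def flip: u_def)
  \<comment> \<open>Here the compatibility of \<open>f\<close> with the projections enters:
    \<open>i p f h = f e h = 0\<close>.\<close>
  moreover have "i (n - 1) (p (n - 1) u) = \<zero>\<^bsub>cpt B (n - 1)\<^esub>"
    using f_proj[OF hx] by (simp add: contraction_proj_h[OF source x] f_zero u_def)
  with contraction_homotopy[OF target u]
  have "\<ominus>\<^bsub>cpt B (n - 1)\<^esub> u = diff B (n - 2) (k (n - 1) u) \<oplus>\<^bsub>cpt B (n - 1)\<^esub> k n (diff B (n - 1) u)"
    using u by (simp add: a_minus_def)
  \<comment> \<open>After reassociating, the last two summands are folded back into
    \<open>- u\<close>.\<close>
  then have "u \<oplus>\<^bsub>cpt B (n - 1)\<^esub> diff B (n - 2) (k (n - 1) u) \<oplus>\<^bsub>cpt B (n - 1)\<^esub> k n (diff B (n - 1) u)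
      = \<zero>\<^bsub>cpt B (n - 1)\<^esub>"
    using u cl by (simp add: B.a_assoc B.r_neg flip: \<open>\<ominus>\<^bsub>cpt B (n - 1)\<^esub> u = _\<close>)
  then have "u \<oplus>\<^bsub>cpt B (n - 1)\<^esub> diff B (n - 2) (k (n - 1) u) = \<ominus>\<^bsub>cpt B (n - 1)\<^esub> k n (diff B (n - 1) u)"
    using u cl by (intro B.minus_equality[symmetric]) simp_all
  moreover have "diff B (n - 1) u = f n (diff N (n - 1) (h n x))"
    using cochain_map_diff[OF f_map hx] by (simp add: u_def)
  ultimately show ?thesis by simp
qed

text \<open>By \<open>k d k = - k\<close>, \<open>k F = k f + k f h d\<close>. Expanding
  \<open>k f\<close> along \<open>Id = e - (d h + h d)\<close> gives
  \<open>- k f d h - k f h d\<close>, as \<open>k f e = k i p f = 0\<close>; the terms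
  \<open>k f h d\<close> cancel. The result has the same form as the one for \<open>F h\<close>, so
  the two can be compared directly.\<close>

lemma k_tilde:
  assumes x: "x \<in> carrier (cpt N n)"
  shows "k n (tilde N B h k f n x) = \<ominus>\<^bsub>cpt B (n - 1)\<^esub> k n (f n (diff N (n - 1) (h n x)))"
proof -
  interpret N: abelian_group "cpt N n" by (rule module_abelian_group[OF source_module])
  interpret B: abelian_group "cpt B (n - 1)" by (rule module_abelian_group[OF target_module])
  note cl = contraction_closed[OF source x]
  note kcl = linear_maps_closed[OF k_linear]
  note kf = linear_maps_comp[OF f_linear k_linear, of n]
  have "k n (null_part n x) = \<ominus>\<^bsub>cpt B (n - 1)\<^esub> k n (f n (h (n + 1) (diff N n x)))"
    unfolding null_part_def by (rule contraction_h_diff_h[OF target f_closed[OF cl(4)]])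
  then have "k n (tilde N B h k f n x)
      = k n (f n x) \<oplus>\<^bsub>cpt B (n - 1)\<^esub> k n (f n (h (n + 1) (diff N n x)))"
    using kcl[OF f_closed[OF cl(4)]] k_minus[OF f_closed[OF x] null_part_closed[OF x]]
    by (simp add: tilde_eq graded_minus_def) (simp add: a_minus_def)
  moreover have "k n (f n x) = \<ominus>\<^bsub>cpt B (n - 1)\<^esub> (k n (f n (diff N (n - 1) (h n x)))
      \<oplus>\<^bsub>cpt B (n - 1)\<^esub> k n (f n (h (n + 1) (diff N n x))))"
  proof -
    \<comment> \<open>\<open>f e = i p f\<close> moves the projection to the target, where
      \<open>k i = 0\<close>.\<close>
    have "k n (f n (\<iota> n (\<pi> n x))) = \<zero>\<^bsub>cpt B (n - 1)\<^esub>"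
      unfolding f_proj[OF x] by (rule contraction_h_proj[OF target f_closed[OF x]])
    then show ?thesis
      using kcl[OF f_closed[OF cl(4)]] kcl[OF f_closed[OF cl(3)]]
      by (subst contraction_decomposition[OF source x])
        (simp add: cl linear_maps_minus[OF source_module target_module kf] linear_maps_add[OF kf],
          simp add: a_minus_def)
  qed
  ultimately show ?thesis
    using kcl[OF f_closed[OF cl(4)]] kcl[OF f_closed[OF cl(3)]]
    by (simp add: B.minus_add B.a_assoc B.l_neg)
qed

lemma tilde_contraction_morphism: "contraction_morphism R M N \<iota> \<pi> h A B i p k (tilde N B h k f)"
  unfolding contraction_morphism_def
  using source target tilde_map by (simp add: tilde_h k_tilde)

text \<open>The characterization of \<open>F\<close> from which (2) and (3) follow: it remains to
  exhibit a contraction morphism with the values of \<open>f\<close> on the images of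
  \<open>e\<close> and \<open>d\<close>.\<close>

lemma tilde_unique:
  assumes "contraction_morphism R M N \<iota> \<pi> h A B i p k g"
    and "\<And>n x. x \<in> carrier (cpt N n) \<Longrightarrow> g n (\<iota> n (\<pi> n x)) = f n (\<iota> n (\<pi> n x))"
    and "\<And>n x. x \<in> carrier (cpt N n) \<Longrightarrow> g (n + 1) (diff N n x) = f (n + 1) (diff N n x)"
  shows "graded_eq N (tilde N B h k f) g"
  using tilde_contraction_morphism assms(1)
  by (rule contraction_morphism_unique) (simp_all add: tilde_proj tilde_diff assms(2,3))

lemma homotopic_minus_tilde: "homotopic R N B (graded_minus B f (tilde N B h k f)) (graded_zero B)"
proof -
  \<comment> \<open>The correction with its outer \<open>d\<close> removed: \<open>d s\<close> is
    the whole correction, and \<open>s d = 0\<close> because \<open>d d = 0\<close>.\<close>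
  define s where "s n x = k n (f n (h (n + 1) (diff N n x)))" for n x
  have "graded_map R N B (- 1) s"
    using k_f_h_diff_linear by (simp add: graded_map_def s_def[abs_def])
  moreover have "graded_minus B f (tilde N B h k f) n x \<ominus>\<^bsub>cpt B n\<^esub> graded_zero B n x
      = diff B (n - 1) (s n x) \<oplus>\<^bsub>cpt B n\<^esub> s (n + 1) (diff N n x)"
    if x: "x \<in> carrier (cpt N n)" for n x
  proof -
    interpret abelian_group "cpt B n" by (rule module_abelian_group[OF target_module])
    have "s (n + 1) (diff N n x) = \<zero>\<^bsub>cpt B n\<^esub>"
      using h_diff_diff[OF x] k_zero[of "n + 1"] by (simp add: s_def add.assoc f_zero)
    moreover have "diff B (n - 1) (s n x) = null_part n x"
      by (simp add: s_def null_part_def)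
    ultimately show ?thesis
      using f_closed[OF x] null_part_closed[OF x]
      by (simp add: tilde_eq graded_minus_def graded_zero_def a_minus_def minus_add r_neg2)
  qed
  ultimately show ?thesis
    unfolding homotopic_def
    using cochain_map_minus[OF f_map tilde_map] cochain_map_zero[OF source_complex target_complex]
    by blast
qed

end

text \<open>The composite of the rectified maps is a contraction morphism, so by uniqueness it
  suffices to compare it with \<open>g f\<close> on the images of \<open>e\<close> and
  \<open>d\<close>.\<close>

lemma tilde_comp:
  assumes f: "retraction_morphism_of_contractions R M N \<iota> \<pi> h A B i p k f"
    and g: "retraction_morphism_of_contractions R A B i p k P Q j q l g"
  shows "graded_eq N (tilde N Q h l (graded_comp g f)) (graded_comp (tilde B Q k l g) (tilde N B h k f))"
proof -
  interpret f: retraction_morphism_of_contractions R M N \<iota> \<pi> h A B i p k f by (rule f)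
  interpret g: retraction_morphism_of_contractions R A B i p k P Q j q l g by (rule g)
  interpret gf: retraction_morphism_of_contractions R M N \<iota> \<pi> h P Q j q l "graded_comp g f"
    by unfold_locales
      (use f.source g.target acyclic_retraction_morphism_comp[OF f.morphism g.morphism] in auto)
  show ?thesis
  proof (rule gf.tilde_unique)
    show "contraction_morphism R M N \<iota> \<pi> h P Q j q l (graded_comp (tilde B Q k l g) (tilde N B h k f))"
      by (rule contraction_morphism_comp[OF f.tilde_contraction_morphism g.tilde_contraction_morphism])
  next
    fix n x assume x: "x \<in> carrier (cpt N n)"
    \<comment> \<open>\<open>F e x = f e x = i p f x\<close> lies in the image of
      \<open>i p\<close>, where the rectification of \<open>g\<close> agrees with
      \<open>g\<close>.\<close>
    show "graded_comp (tilde B Q k l g) (tilde N B h k f) n (\<iota> n (\<pi> n x)) = graded_comp g f n (\<iota> n (\<pi> n x))"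
      by (simp add: graded_comp_def f.tilde_proj[OF x] f.f_proj[OF x] g.tilde_proj[OF f.f_closed[OF x]])
    \<comment> \<open>Likewise \<open>F d x = f d x = d f x\<close> lies in the image of the
      differential of \<open>B\<close>.\<close>
    show "graded_comp (tilde B Q k l g) (tilde N B h k f) (n + 1) (diff N n x)
        = graded_comp g f (n + 1) (diff N n x)"
      by (simp add: graded_comp_def f.tilde_diff[OF x] cochain_map_diff[OF f.f_map x]
          g.tilde_diff[OF f.f_closed[OF x]])
  qed
qed

theorem lemma3p4:
  fixes R :: "('r, 'z) ring_scheme"
    and M :: "('r, 'm) cochain" and N :: "('r, 'n) cochain"
    and \<iota> :: "int \<Rightarrow> 'm \<Rightarrow> 'n" and \<pi> :: "int \<Rightarrow> 'n \<Rightarrow> 'm" and h :: "int \<Rightarrow> 'n \<Rightarrow> 'n"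
    and A :: "('r, 'a) cochain" and B :: "('r, 'b) cochain"
    and i :: "int \<Rightarrow> 'a \<Rightarrow> 'b" and p :: "int \<Rightarrow> 'b \<Rightarrow> 'a" and k :: "int \<Rightarrow> 'b \<Rightarrow> 'b"
    and f :: "int \<Rightarrow> 'n \<Rightarrow> 'b"
  assumes "cring R"
    and "contraction R M N \<iota> \<pi> h"
    and "contraction R A B i p k"
    and "acyclic_retraction_morphism R M N \<iota> \<pi> A B i p f"
  shows "contraction_morphism R M N \<iota> \<pi> h A B i p k (tilde N B h k f)
    \<and> homotopic R N B (graded_minus B f (tilde N B h k f)) (graded_zero B)
    \<and> (contraction_morphism R M N \<iota> \<pi> h A B i p k f \<longrightarrow> graded_eq N (tilde N B h k f) f)
    \<and> (\<forall>(P :: ('r, 'p) cochain) (Q :: ('r, 'q) cochain) j q l g.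
         contraction R P Q j q l \<and> acyclic_retraction_morphism R A B i p P Q j q g \<longrightarrow>
         graded_eq N (tilde N Q h l (graded_comp g f))
                     (graded_comp (tilde B Q k l g) (tilde N B h k f)))"
proof -
  interpret retraction_morphism_of_contractions R M N \<iota> \<pi> h A B i p k f
    using assms(2-4) by unfold_locales
  show ?thesis
  proof (intro conjI allI impI)
    show "contraction_morphism R M N \<iota> \<pi> h A B i p k (tilde N B h k f)"
      by (rule tilde_contraction_morphism)
    show "homotopic R N B (graded_minus B f (tilde N B h k f)) (graded_zero B)"
      by (rule homotopic_minus_tilde)
    show "graded_eq N (tilde N B h k f) f" if "contraction_morphism R M N \<iota> \<pi> h A B i p k f"
      \<comment> \<open>\<open>f\<close> itself is the candidate, so the two agreement conditions
        are trivial.\<close>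
      using that by (rule tilde_unique) simp_all
  next
    fix P :: "('r, 'p) cochain" and Q :: "('r, 'q) cochain" and j q l g
    assume "contraction R P Q j q l \<and> acyclic_retraction_morphism R A B i p P Q j q g"
    then have "retraction_morphism_of_contractions R A B i p k P Q j q l g"
      using target by unfold_locales auto
    with retraction_morphism_of_contractions_axioms
    show "graded_eq N (tilde N Q h l (graded_comp g f))
        (graded_comp (tilde B Q k l g) (tilde N B h k f))"
      by (rule tilde_comp)
  qed
qed

end
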